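(* For every integer $k\geq 0$ there are infinitely many $n$ such that every deterministic OBDD on $n$ variables computing the partial function $\mathtt{PartialMOD^k_n}$ has width at least $2^{k+1}$.
   Context: For $\nu\in\{0,1\}^n$ let $\#_1(\nu)$ be the number of ones in $\nu$. The partial function $\mathtt{PartialMOD^k_n}$ on $\{0,1\}^n$ is defined by $\mathtt{PartialMOD^k_n}(\nu)=1$ if $\#_1(\nu)\equiv 0 \pmod{2^{k+1}}$, $\mathtt{PartialMOD^k_n}(\nu)=0$ if $\#_1(\nu)\equiv 2^k \pmod{2^{k+1}}$, and it is undefined otherwise. A deterministic OBDD on variables $x_1,\dots,x_n$ with order $\pi$ (a permutation of $\{1,\dots,n\}$) is a leveled directed acyclic graph with levels $0,\dots,n$, a single source node at level $0$, where every node at level $j-1$ ($1\le j\le n$) has exactly one outgoing edge labelled $0$ and one labelled $1$, both going to nodes at level $j$, and the nodes at level $n$ are marked accepting or rejecting. On input $\nu$ the computation starts at the source and at step $j$ follows the edge labelled $\nu_{\pi(j)}$; the input is accepted iff the reached node at level $n$ is accepting. Its width is the maximum number of nodes in a level. It computes a partial function $f$ if it accepts every $\nu$ with $f(\nu)=1$ and rejects every $\nu$ with $f(\nu)=0$ (no requirement on undefined inputs). *)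

theory Defs
  imports "HOL-Combinatorics.Permutations"
begin

text \<open>
  An input \<open>\<nu> \<in> {0,1}\<^sup>n\<close> is a function \<open>nat \<Rightarrow> bool\<close>, of which only the values on \<open>{1..n}\<close>
  are ever inspected.
\<close>

definition num_ones :: "nat \<Rightarrow> (nat \<Rightarrow> bool) \<Rightarrow> nat" where
  "num_ones n \<nu> = card {i \<in> {1..n}. \<nu> i}"

definition PartialMOD :: "nat \<Rightarrow> nat \<Rightarrow> (nat \<Rightarrow> bool) \<Rightarrow> bool option" where
  "PartialMOD k n \<nu> =
     (if num_ones n \<nu> mod 2 ^ (k + 1) = 0 then Some True
      else if num_ones n \<nu> mod 2 ^ (k + 1) = 2 ^ k then Some False
      else None)"

text \<open>
  \<open>succ B v b\<close> is the endpoint of the unique edge labelled \<open>b\<close> leaving \<open>v\<close>; it is relevant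
  only for nodes on the levels \<open>0, \<dots>, n - 1\<close>.
\<close>

record 'v obdd =
  var_order :: "nat \<Rightarrow> nat"
  level :: "nat \<Rightarrow> 'v set"
  source :: 'v
  succ :: "'v \<Rightarrow> bool \<Rightarrow> 'v"
  accepting :: "'v set"

definition is_obdd :: "nat \<Rightarrow> 'v obdd \<Rightarrow> bool" where
  "is_obdd n B \<longleftrightarrow>
     var_order B permutes {1..n} \<and>
     (\<forall>j\<in>{0..n}. finite (level B j)) \<and>
     disjoint_family_on (level B) {0..n} \<and>
     level B 0 = {source B} \<and>
     (\<forall>j\<in>{1..n}. \<forall>v\<in>level B (j - 1). \<forall>b. succ B v b \<in> level B j) \<and>
     accepting B \<subseteq> level B n"

primrec reached :: "'v obdd \<Rightarrow> (nat \<Rightarrow> bool) \<Rightarrow> nat \<Rightarrow> 'v" where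
  "reached B \<nu> 0 = source B"
| "reached B \<nu> (Suc j) = succ B (reached B \<nu> j) (\<nu> (var_order B (Suc j)))"

definition accepts :: "nat \<Rightarrow> 'v obdd \<Rightarrow> (nat \<Rightarrow> bool) \<Rightarrow> bool" where
  "accepts n B \<nu> \<longleftrightarrow> reached B \<nu> n \<in> accepting B"

definition width :: "nat \<Rightarrow> 'v obdd \<Rightarrow> nat" where
  "width n B = Max ((\<lambda>j. card (level B j)) ` {0..n})"

definition computes :: "nat \<Rightarrow> 'v obdd \<Rightarrow> ((nat \<Rightarrow> bool) \<Rightarrow> bool option) \<Rightarrow> bool" where
  "computes n B f \<longleftrightarrow>
     (\<forall>\<nu>. (f \<nu> = Some True \<longrightarrow> accepts n B \<nu>) \<and> (f \<nu> = Some False \<longrightarrow> \<not> accepts n B \<nu>))"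

end

theory Submission
  imports Defs
begin

text \<open>
  Put \<open>d = 2 ^ (k + 1)\<close> and attach to each node the set \<open>R\<close> of numbers of ones, modulo \<open>d\<close>, of the
  partial inputs leading to it. As long as at least \<open>d\<close> variables remain unread, \<open>R\<close> cannot contain
  two residues differing by \<open>2 ^ k\<close>. Every nontrivial subgroup of \<open>\<int>/d\<int>\<close> contains \<open>2 ^ k\<close>, so
  the \<open>d\<close> translates of a nonempty \<open>R\<close> are pairwise distinct. Reading \<open>i < d\<close> ones among the next
  \<open>d\<close> variables leads from a node with set \<open>R\<close> to a node whose set contains \<open>R + i\<close>. Either one of
  these \<open>d\<close> sets is strictly larger than \<open>R\<close>, or they are exactly the \<open>d\<close> distinct translates and
  the level has at least \<open>d\<close> nodes. The first case cannot occur \<open>d\<close> times in a row.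
\<close>

section \<open>Arithmetic modulo a power of two\<close>

text \<open>While \<open>s\<close> is even, \<open>s\<close> and the modulus can be halved together;
  for odd \<open>s\<close> the multiplier \<open>2 ^ k\<close> works.\<close>

lemma ex_multiple_eq_half_modulus:
  fixes s k :: nat
  assumes "0 < s" "s < 2 ^ (k + 1)"
  shows "\<exists>q. (q * s) mod 2 ^ (k + 1) = 2 ^ k"
  using assms
proof (induction k arbitrary: s)
  case 0
  then have "s = 1" by simp
  then show ?case by (intro exI[of _ 1]) simp
next
  case (Suc k)
  show ?case
  proof (cases "even s")
    case True
    then obtain r where r: "s = 2 * r" by blast
    with Suc.prems have "0 < r" "r < 2 ^ (k + 1)" by auto
    then obtain q where "(q * r) mod 2 ^ (k + 1) = 2 ^ k" using Suc.IH by blast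
    then have "(2 * (q * r)) mod (2 * 2 ^ (k + 1)) = 2 * 2 ^ k"
      by (simp only: mult_mod_right[symmetric])
    then show ?thesis using r by (intro exI[of _ q]) (simp add: ac_simps)
  next
    case False
    then obtain r where r: "s = 2 * r + 1" by (elim oddE)
    have "2 ^ Suc k * s = 2 ^ Suc k + 2 ^ (Suc k + 1) * r"
      by (simp add: r algebra_simps)
    then have "(2 ^ Suc k * s) mod 2 ^ (Suc k + 1) = (2::nat) ^ Suc k" by simp
    then show ?thesis by blast
  qed
qed

lemma mod_add_right_cancel_nat:
  fixes x y i d :: nat
  assumes "(x + i) mod d = (y + i) mod d"
  shows "x mod d = y mod d"
proof -
  obtain q1 q2 where "x + i + d * q1 = y + i + d * q2" using assms nat_mod_eq_iff by blast
  then have "x + d * q1 = y + d * q2" by simp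
  then show ?thesis using nat_mod_eq_iff by blast
qed

text \<open>Equal translates make \<open>R\<close> invariant under adding \<open>i' - i\<close>,
  hence under adding its multiples, one of which is \<open>2 ^ k\<close> modulo
  \<open>d\<close>.\<close>

lemma translates_eq_imp_half_modulus:
  fixes R :: "nat set" and k i i' :: nat
  defines "d \<equiv> (2::nat) ^ (k + 1)"
  assumes R: "R \<subseteq> {..<d}" and a: "a \<in> R"
    and i: "i < i'" "i' < d"
    and eq: "(\<lambda>x. (x + i) mod d) ` R = (\<lambda>x. (x + i') mod d) ` R"
  shows "(a + 2 ^ k) mod d \<in> R"
proof -
  define s where "s = i' - i"
  have s: "i' = s + i" "0 < s" "s < 2 ^ (k + 1)" using i by (auto simp: s_def d_def)
  have step: "(b + s) mod d \<in> R" if "b \<in> R" for b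
  proof -
    from that eq have "(b + i') mod d \<in> (\<lambda>x. (x + i) mod d) ` R" by auto
    then obtain c where c: "c \<in> R" "(b + s + i) mod d = (c + i) mod d"
      by (auto simp: s(1) add.assoc)
    then have "(b + s) mod d = c mod d" using mod_add_right_cancel_nat by blast
    then show ?thesis using c(1) R by auto
  qed
  have "(a + q * s) mod d \<in> R" for q
  proof (induction q)
    case 0
    then show ?case using a R by auto
  next
    case (Suc q)
    from step[OF this] show ?case by (simp add: mod_simps ac_simps)
  qed
  moreover obtain q where "(q * s) mod d = 2 ^ k"
    using ex_multiple_eq_half_modulus[OF s(2,3)] unfolding d_def by blast
  ultimately show ?thesis by (metis mod_add_right_eq)
qed

section \<open>Paths and their numbers of ones\<close>

text \<open>Forgetting the input and keeping only the count \<open>c\<close> of ones read lets paths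
  be prolonged without handling assignments.\<close>

inductive reach :: "'v obdd \<Rightarrow> nat \<Rightarrow> nat \<Rightarrow> 'v \<Rightarrow> bool" for B where
  reach_0: "reach B 0 0 (source B)"
| reach_Suc: "reach B j c v \<Longrightarrow> reach B (Suc j) (c + of_bool b) (succ B v b)"

lemma reached_cong:
  assumes "\<And>i. i \<in> {1..j} \<Longrightarrow> \<nu> (var_order B i) = \<nu>' (var_order B i)"
  shows "reached B \<nu> j = reached B \<nu>' j"
  using assms by (induction j) auto

lemma reach_imp_reached:
  assumes "reach B j c v" "inj (var_order B)"
  shows "\<exists>\<nu>. reached B \<nu> j = v \<and> card {i \<in> {1..j}. \<nu> (var_order B i)} = c"
  using assms(1)
proof induction
  case reach_0
  then show ?case by simp
next
  case (reach_Suc j c v b)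
  then obtain \<nu> where \<nu>: "reached B \<nu> j = v" "card {i \<in> {1..j}. \<nu> (var_order B i)} = c"
    by blast
  \<comment> \<open>By injectivity the variable overwritten here was not read in the first
    \<open>j\<close> steps.\<close>
  define \<nu>' where "\<nu>' = \<nu>(var_order B (Suc j) := b)"
  have same: "\<nu>' (var_order B i) = \<nu> (var_order B i)" if "i \<in> {1..j}" for i
    using that injD[OF assms(2), of i "Suc j"] by (auto simp: \<nu>'_def)
  have "reached B \<nu>' (Suc j) = succ B v b"
    using reached_cong[of j \<nu>' B \<nu>] same \<nu>(1) by (simp add: \<nu>'_def)
  moreover have "{i \<in> {1..Suc j}. \<nu>' (var_order B i)} =
      {i \<in> {1..j}. \<nu> (var_order B i)} \<union> (if b then {Suc j} else {})"
    using same inj_eq[OF assms(2)] by (auto simp: \<nu>'_def le_Suc_eq)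
  then have "card {i \<in> {1..Suc j}. \<nu>' (var_order B i)} = c + of_bool b"
    using \<nu>(2) by (auto simp: card_insert_if)
  ultimately show ?case by blast
qed

lemma num_ones_var_order:
  assumes "p permutes {1..n}"
  shows "card {i \<in> {1..n}. \<nu> (p i)} = num_ones n \<nu>"
proof -
  have "{i \<in> {1..n}. \<nu> i} = p ` {i \<in> {1..n}. \<nu> (p i)}"
  proof (intro equalityI subsetI)
    fix i assume i: "i \<in> {i \<in> {1..n}. \<nu> i}"
    then obtain m where "m \<in> {1..n}" "i = p m" using permutes_image[OF assms] by blast
    with i show "i \<in> p ` {i \<in> {1..n}. \<nu> (p i)}" by blast
  next
    fix i assume "i \<in> p ` {i \<in> {1..n}. \<nu> (p i)}"
    then show "i \<in> {i \<in> {1..n}. \<nu> i}"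
      using permutes_in_image[OF assms] by auto
  qed
  then show ?thesis
    unfolding num_ones_def using permutes_inj_on[OF assms] by (simp add: card_image)
qed

lemma reach_level:
  assumes "reach B j c v" "is_obdd n B" "j \<le> n"
  shows "v \<in> level B j"
  using assms
proof induction
  case reach_0
  then show ?case by (simp add: is_obdd_def)
next
  case (reach_Suc j c v b)
  then show ?case by (fastforce simp: is_obdd_def dest: bspec[of _ _ "Suc j"])
qed

text \<open>The labels appended depend only on \<open>e\<close>, so one endpoint \<open>u\<close>
  serves all counts \<open>c\<close> at \<open>v\<close>; this uniformity lets different histories
  be compared.\<close>

lemma reach_extend:
  assumes "e \<le> m"
  shows "\<exists>u. \<forall>c. reach B j c v \<longrightarrow> reach B (j + m) (c + e) u"
  using assms
proof (induction m arbitrary: e)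
  case 0
  then show ?case by auto
next
  case (Suc m)
  \<comment> \<open>The last label is a one unless \<open>e = 0\<close>, so at most \<open>m\<close>
    ones are left for the first \<open>m\<close> labels.\<close>
  define b where "b \<longleftrightarrow> e \<noteq> 0"
  have "e - of_bool b \<le> m" using Suc.prems by (auto simp: b_def)
  then obtain u where "\<forall>c. reach B j c v \<longrightarrow> reach B (j + m) (c + (e - of_bool b)) u"
    using Suc.IH by blast
  then have "\<forall>c. reach B j c v \<longrightarrow>
      reach B (Suc (j + m)) (c + (e - of_bool b) + of_bool b) (succ B u b)"
    by (blast intro: reach.reach_Suc)
  then show ?case by (intro exI[of _ "succ B u b"]) (auto simp: b_def)
qed

lemma reach_end_accepting:
  assumes "is_obdd n B" "computes n B (PartialMOD k n)" "reach B n c v"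
  shows "c mod 2 ^ (k + 1) = 0 \<Longrightarrow> v \<in> accepting B"
    and "c mod 2 ^ (k + 1) = 2 ^ k \<Longrightarrow> v \<notin> accepting B"
proof -
  have p: "var_order B permutes {1..n}" using assms(1) by (simp add: is_obdd_def)
  obtain \<nu> where \<nu>: "reached B \<nu> n = v" "num_ones n \<nu> = c"
    using reach_imp_reached[OF assms(3) permutes_inj[OF p]] num_ones_var_order[OF p] by metis
  have "PartialMOD k n \<nu> = Some True \<Longrightarrow> v \<in> accepting B"
    "PartialMOD k n \<nu> = Some False \<Longrightarrow> v \<notin> accepting B"
    using assms(2) \<nu>(1) by (auto simp: computes_def accepts_def)
  then show "c mod 2 ^ (k + 1) = 0 \<Longrightarrow> v \<in> accepting B"
    and "c mod 2 ^ (k + 1) = 2 ^ k \<Longrightarrow> v \<notin> accepting B"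
    using \<nu>(2) by (simp_all add: PartialMOD_def)
qed

section \<open>Residue sets of nodes\<close>

text \<open>The set \<open>R\<close> of the overview; it is nonempty exactly when some path of
  length \<open>j\<close> ends in \<open>v\<close>.\<close>

definition residues_at :: "nat \<Rightarrow> 'v obdd \<Rightarrow> nat \<Rightarrow> 'v \<Rightarrow> nat set" where
  "residues_at d B j v = (\<lambda>c. c mod d) ` {c. reach B j c v}"

lemma residues_at_subset: "0 < d \<Longrightarrow> residues_at d B j v \<subseteq> {..<d}"
  by (auto simp: residues_at_def)

lemma residues_at_nonempty_level:
  assumes "residues_at d B j v \<noteq> {}" "is_obdd n B" "j \<le> n"
  shows "v \<in> level B j"
  using assms reach_level by (fastforce simp: residues_at_def)

lemma residues_at_translate:
  assumes "e \<le> m"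
  shows "\<exists>u. (\<lambda>x. (x + e) mod d) ` residues_at d B j v \<subseteq> residues_at d B (j + m) u"
proof -
  obtain u where u: "\<forall>c. reach B j c v \<longrightarrow> reach B (j + m) (c + e) u"
    using reach_extend[OF assms, of B j v] by blast
  have "(c mod d + e) mod d \<in> residues_at d B (j + m) u" if "reach B j c v" for c
  proof -
    have "(c + e) mod d \<in> residues_at d B (j + m) u"
      using u that unfolding residues_at_def by blast
    then show ?thesis by (simp add: mod_add_left_eq)
  qed
  then show ?thesis unfolding residues_at_def[of d B j v] by blast
qed

text \<open>Otherwise one common completion brings the two counts to residues \<open>0\<close> and
  \<open>2 ^ k\<close> at the same final node, which would have to be both accepting and not
  accepting.\<close>

lemma residues_at_no_half_modulus:
  fixes k n :: nat
  defines "d \<equiv> (2::nat) ^ (k + 1)"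
  assumes B: "is_obdd n B" "computes n B (PartialMOD k n)"
    and j: "j + d \<le> n" and a: "a \<in> residues_at d B j v"
  shows "(a + 2 ^ k) mod d \<notin> residues_at d B j v"
proof
  assume "(a + 2 ^ k) mod d \<in> residues_at d B j v"
  then obtain c' where c': "reach B j c' v" "c' mod d = (a + 2 ^ k) mod d"
    by (auto simp: residues_at_def)
  obtain c where c: "reach B j c v" "c mod d = a" using a by (auto simp: residues_at_def)
  have d: "0 < d" "2 ^ k < d" by (simp_all add: d_def)
  then have "a < d" using c(2) by auto
  \<comment> \<open>The \<open>d\<close> unread variables suffice even for \<open>a = 0\<close>,
    where \<open>e = d\<close>.\<close>
  define e where "e = d - a"
  have "e \<le> n - j" using j by (simp add: e_def)
  then obtain u where u: "\<forall>c. reach B j c v \<longrightarrow> reach B (j + (n - j)) (c + e) u"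
    using reach_extend[of e "n - j" B j v] by blast
  have n: "j + (n - j) = n" using j by simp
  have "(c + e) mod d = (a + e) mod d" by (simp add: c(2)[symmetric] mod_simps)
  also have "\<dots> = 0" using \<open>a < d\<close> by (simp add: e_def)
  finally have "u \<in> accepting B"
    using reach_end_accepting(1)[OF B, of "c + e" u] u c(1) by (simp add: n d_def)
  have "(c' + e) mod d = (a + 2 ^ k + e) mod d" using c'(2) by (metis mod_add_left_eq)
  also have "a + 2 ^ k + e = 2 ^ k + d" using \<open>a < d\<close> by (simp add: e_def)
  also have "(2 ^ k + d) mod d = 2 ^ k" using d by simp
  finally have "u \<notin> accepting B"
    using reach_end_accepting(2)[OF B, of "c' + e" u] u c'(1) by (simp add: n d_def)
  then show False using \<open>u \<in> accepting B\<close> by contradiction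
qed

section \<open>Growth of residue sets and the width bound\<close>

lemma card_level_le_width: "j \<le> n \<Longrightarrow> card (level B j) \<le> width n B"
  by (auto simp: width_def intro!: Max_ge)

lemma residues_at_grow:
  fixes k n :: nat
  defines "d \<equiv> (2::nat) ^ (k + 1)"
  assumes B: "is_obdd n B" "computes n B (PartialMOD k n)" and width: "width n B < d"
    and j: "j + d \<le> n" and v: "residues_at d B j v \<noteq> {}"
  shows "\<exists>u. card (residues_at d B j v) < card (residues_at d B (j + d) u)"
proof (rule ccontr)
  assume no: "\<not> ?thesis"
  let ?R = "residues_at d B j v"
  let ?T = "\<lambda>i. (\<lambda>x. (x + i) mod d) ` ?R"
  have d: "0 < d" by (simp add: d_def)
  have R: "?R \<subseteq> {..<d}" using d by (rule residues_at_subset)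
  have card_T: "card (?T i) = card ?R" for i
  proof (rule card_image, rule inj_onI)
    fix x y assume "x \<in> ?R" "y \<in> ?R" "(x + i) mod d = (y + i) mod d"
    moreover from this have "x < d" "y < d" using R by auto
    ultimately show "x = y" using mod_add_right_cancel_nat[of x i d y] by simp
  qed
  have "\<forall>i. \<exists>u. i < d \<longrightarrow> ?T i \<subseteq> residues_at d B (j + d) u"
    using residues_at_translate[OF less_imp_le, of _ d d B j v] by blast
  then obtain f where f: "\<And>i. i < d \<Longrightarrow> ?T i \<subseteq> residues_at d B (j + d) (f i)"
    by metis
  \<comment> \<open>Without growth, the set at \<open>f i\<close> is no larger than the translate it
    contains, so the two coincide.\<close>
  have T: "?T i = residues_at d B (j + d) (f i)" if "i < d" for i
  proof (rule card_seteq)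
    show "finite (residues_at d B (j + d) (f i))"
      using residues_at_subset[OF d] finite_lessThan by (rule finite_subset)
    show "?T i \<subseteq> residues_at d B (j + d) (f i)" using f that .
    show "card (residues_at d B (j + d) (f i)) \<le> card (?T i)"
      using no card_T by (simp add: not_less)
  qed
  have distinct: "f i \<noteq> f i'" if "i < i'" "i' < d" for i i'
  proof
    assume "f i = f i'"
    with T that have "?T i = ?T i'" by (metis less_trans)
    moreover obtain a where a: "a \<in> ?R" using v by blast
    ultimately have "(a + 2 ^ k) mod d \<in> ?R"
      using translates_eq_imp_half_modulus R that unfolding d_def by blast
    then show False
      using residues_at_no_half_modulus[OF B] j a unfolding d_def by blast
  qed
  have "inj_on f {..<d}"
    by (rule linorder_inj_onI) (use distinct in auto)
  moreover have "f ` {..<d} \<subseteq> level B (j + d)"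
  proof
    fix u assume "u \<in> f ` {..<d}"
    then obtain i where "i < d" "u = f i" by auto
    \<comment> \<open>A nonempty residue set certifies that \<open>u\<close> is a reached node,
      hence lies on the level.\<close>
    with T[of i] v have "residues_at d B (j + d) u \<noteq> {}" by (metis image_is_empty)
    then show "u \<in> level B (j + d)" using B(1) j by (rule residues_at_nonempty_level)
  qed
  moreover have "finite (level B (j + d))" using B(1) j by (simp add: is_obdd_def)
  ultimately have "d \<le> card (level B (j + d))"
    by (metis card_image card_lessThan card_mono)
  then show False using card_level_le_width[OF j, of B] width by simp
qed

text \<open>The first \<open>d * d\<close> variables form \<open>d\<close> blocks of length
  \<open>d\<close>. If the width were below \<open>d\<close>, each block would yield a node with a
  larger residue set, giving more than \<open>d\<close> residues modulo \<open>d\<close> in the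
  end.\<close>

lemma width_ge_if_computes_PartialMOD:
  fixes k n :: nat
  defines "d \<equiv> (2::nat) ^ (k + 1)"
  assumes B: "is_obdd n B" "computes n B (PartialMOD k n)" and n: "d * d \<le> n"
  shows "d \<le> width n B"
proof (rule ccontr)
  assume "\<not> d \<le> width n B"
  then have width: "width n B < d" by simp
  have d: "0 < d" by (simp add: d_def)
  \<comment> \<open>The inequality is strict because the source already carries the residue
    \<open>0\<close>; at \<open>t = d\<close> this exceeds the \<open>d\<close> possible
    residues.\<close>
  have "\<exists>v. t < card (residues_at d B (t * d) v)" if "t \<le> d" for t
    using that
  proof (induction t)
    case 0
    have "0 mod d \<in> residues_at d B 0 (source B)"
      unfolding residues_at_def by (blast intro: reach_0)
    moreover have "finite (residues_at d B 0 (source B))"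
      using residues_at_subset[OF d] finite_lessThan by (rule finite_subset)
    ultimately have "0 < card (residues_at d B 0 (source B))" by (auto simp: card_gt_0_iff)
    then show ?case by auto
  next
    case (Suc t)
    then obtain v where v: "t < card (residues_at d B (t * d) v)" by auto
    then have "residues_at d B (t * d) v \<noteq> {}" by auto
    moreover have "t * d + d \<le> n"
      using mult_le_mono1[OF Suc.prems, of d] n by simp
    ultimately obtain u
      where "card (residues_at d B (t * d) v) < card (residues_at d B (t * d + d) u)"
      using residues_at_grow[OF B] width unfolding d_def by blast
    with v have "Suc t < card (residues_at d B (Suc t * d) u)" by (simp add: add.commute)
    then show ?case by blast
  qed
  then obtain v where "d < card (residues_at d B (d * d) v)" by blast
  moreover have "card (residues_at d B (d * d) v) \<le> card {..<d}"
    using finite_lessThan residues_at_subset[OF d] by (rule card_mono)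
  ultimately show False by simp
qed

theorem theorem2:
  fixes k :: nat
  shows "infinite {n. \<forall>B :: 'v obdd.
           is_obdd n B \<and> computes n B (PartialMOD k n) \<longrightarrow> 2 ^ (k + 1) \<le> width n B}"
proof (rule infinite_super)
  show "{2 ^ (k + 1) * 2 ^ (k + 1)..} \<subseteq> {n. \<forall>B :: 'v obdd.
           is_obdd n B \<and> computes n B (PartialMOD k n) \<longrightarrow> 2 ^ (k + 1) \<le> width n B}"
    using width_ge_if_computes_PartialMOD by blast
  show "infinite {(2::nat) ^ (k + 1) * 2 ^ (k + 1)..}" by (rule infinite_Ici)
qed

end
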